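(* Let $b\in\mathbb C$ and let $g\in\mathbb C[t]$ be a polynomial with zero constant term and $\deg g\geq2$. The $\mathfrak{sl}(2)$-module $T_1(g,b)$ is simple if and only if $b\notin1+\tfrac12\mathbb Z_{\geq0}$.
   Context: The Lie algebra $\mathfrak{sl}(2)$ over $\mathbb C$ has basis $e,f,h$ with $[h,e]=e$, $[h,f]=-f$, $[e,f]=2h$. $T_1(g,b)$ denotes the space $\mathbb C[t]e^g$ (with $\partial=d/dt$ acting by $\partial(pe^g)=(p'+pg')e^g$) regarded as an $\mathfrak{sl}(2)$-module via $e\mapsto t^2\partial+2bt$, $f\mapsto-\partial$, $h\mapsto t\partial+b$. *)

theory Defs
  imports
    "HOL-Analysis.Analysis"
    "HOL-Computational_Algebra.Polynomial"
    "HOL-Library.Function_Algebras"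
begin

section \<open>Modules over Lie algebras\<close>

text \<open>
  A Lie algebra lives on a subspace \<open>L\<close> of an ambient vector space, and so does a module \<open>M\<close>
  over it. The bracket and the action are total functions, constrained on \<open>L\<close> and \<open>M\<close> only.
\<close>

locale lie_algebra = LV: vector_space sL
  for sL :: "'k::field \<Rightarrow> 'l::ab_group_add \<Rightarrow> 'l" +
  fixes L :: "'l set" and br :: "'l \<Rightarrow> 'l \<Rightarrow> 'l"
  assumes subspace_L: "LV.subspace L"
    and br_closed: "\<lbrakk>x \<in> L; y \<in> L\<rbrakk> \<Longrightarrow> br x y \<in> L"
    and br_add_left: "\<lbrakk>x \<in> L; y \<in> L; z \<in> L\<rbrakk> \<Longrightarrow> br (x + y) z = br x z + br y z"
    and br_scale_left: "\<lbrakk>x \<in> L; y \<in> L\<rbrakk> \<Longrightarrow> br (sL c x) y = sL c (br x y)"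
    and br_add_right: "\<lbrakk>x \<in> L; y \<in> L; z \<in> L\<rbrakk> \<Longrightarrow> br x (y + z) = br x y + br x z"
    and br_scale_right: "\<lbrakk>x \<in> L; y \<in> L\<rbrakk> \<Longrightarrow> br x (sL c y) = sL c (br x y)"
    and br_self: "x \<in> L \<Longrightarrow> br x x = 0"
    and jacobi: "\<lbrakk>x \<in> L; y \<in> L; z \<in> L\<rbrakk> \<Longrightarrow> br x (br y z) + br y (br z x) + br z (br x y) = 0"

locale lie_module = lie_algebra sL L br + MV: vector_space sM
  for sL :: "'k::field \<Rightarrow> 'l::ab_group_add \<Rightarrow> 'l" and L :: "'l set" and br :: "'l \<Rightarrow> 'l \<Rightarrow> 'l"
    and sM :: "'k \<Rightarrow> 'm::ab_group_add \<Rightarrow> 'm" +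
  fixes M :: "'m set" and act :: "'l \<Rightarrow> 'm \<Rightarrow> 'm"
  assumes subspace_M: "MV.subspace M"
    and act_closed: "\<lbrakk>x \<in> L; v \<in> M\<rbrakk> \<Longrightarrow> act x v \<in> M"
    and act_add_left: "\<lbrakk>x \<in> L; y \<in> L; v \<in> M\<rbrakk> \<Longrightarrow> act (x + y) v = act x v + act y v"
    and act_scale_left: "\<lbrakk>x \<in> L; v \<in> M\<rbrakk> \<Longrightarrow> act (sL c x) v = sM c (act x v)"
    and act_add_right: "\<lbrakk>x \<in> L; v \<in> M; w \<in> M\<rbrakk> \<Longrightarrow> act x (v + w) = act x v + act x w"
    and act_scale_right: "\<lbrakk>x \<in> L; v \<in> M\<rbrakk> \<Longrightarrow> act x (sM c v) = sM c (act x v)"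
    and act_br: "\<lbrakk>x \<in> L; y \<in> L; v \<in> M\<rbrakk> \<Longrightarrow> act (br x y) v = act x (act y v) - act y (act x v)"
begin

definition lie_submodule :: "'m set \<Rightarrow> bool" where
  "lie_submodule N \<longleftrightarrow> N \<subseteq> M \<and> MV.subspace N \<and> (\<forall>x\<in>L. \<forall>v\<in>N. act x v \<in> N)"

end

locale simple_lie_module = lie_module +
  assumes nontrivial: "M \<noteq> {0}"
    and submodule_cases: "lie_submodule N \<Longrightarrow> N = {0} \<or> N = M"


section \<open>The Lie algebra \<open>sl(2)\<close>\<close>

definition mat_scale :: "complex \<Rightarrow> complex^2^2 \<Rightarrow> complex^2^2" where
  "mat_scale c A = (\<chi> i j. c * A $ i $ j)"

definition sl2 :: "(complex^2^2) set" where
  "sl2 = {A. trace A = 0}"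

definition comm :: "complex^2^2 \<Rightarrow> complex^2^2 \<Rightarrow> complex^2^2" where
  "comm A B = A ** B - B ** A"

text \<open>The basis is normalised by \<open>[h,e] = e\<close>, \<open>[h,f] = -f\<close>, \<open>[e,f] = 2h\<close>, so \<open>h\<close> is one half of
  the usual diagonal matrix.\<close>

definition sl2_e :: "complex^2^2" where "sl2_e = vector [vector [0, 1], vector [0, 0]]"
definition sl2_f :: "complex^2^2" where "sl2_f = vector [vector [0, 0], vector [1, 0]]"
definition sl2_h :: "complex^2^2" where "sl2_h = vector [vector [1/2, 0], vector [0, - 1/2]]"

lemmas sl2_basis_defs = sl2_e_def sl2_f_def sl2_h_def

lemma sl2_basis_in: "sl2_e \<in> sl2" "sl2_f \<in> sl2" "sl2_h \<in> sl2"
  by (simp_all add: sl2_def trace_def sum_2 sl2_basis_defs)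

lemma sl2_relations:
  "comm sl2_h sl2_e = sl2_e" "comm sl2_h sl2_f = - sl2_f" "comm sl2_e sl2_f = mat_scale 2 sl2_h"
  by (simp_all add: comm_def sl2_basis_defs mat_scale_def matrix_matrix_mult_def vec_eq_iff
      forall_2 sum_2)

lemma sl2_decomposition:
  assumes "X \<in> sl2"
  shows "X = mat_scale (X$1$2) sl2_e + mat_scale (X$2$1) sl2_f + mat_scale (2 * X$1$1) sl2_h"
  using assms
  by (simp add: sl2_def trace_def sl2_basis_defs mat_scale_def vec_eq_iff forall_2 sum_2
      add_eq_0_iff)

lemma sl2_lie_algebra: "lie_algebra mat_scale sl2 comm"
proof -
  interpret vector_space mat_scale
    by unfold_locales (simp_all add: mat_scale_def vec_eq_iff algebra_simps)
  have "subspace sl2"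
    by (auto simp: subspace_def sl2_def trace_def sum_2 mat_scale_def algebra_simps)
      (metis distrib_left mult_zero_right)
  then show ?thesis
    by unfold_locales
      (simp_all add: sl2_def trace_def sum_2 comm_def mat_scale_def
        matrix_matrix_mult_def vec_eq_iff forall_2 algebra_simps)
qed


section \<open>The modules \<open>T\<^sub>1(g,b)\<close>\<close>

text \<open>
  Elements \<open>p e\<^sup>g\<close> are the functions \<open>t \<mapsto> p(t) exp(g(t))\<close> on the complex plane, and \<open>\<partial>\<close> is
  the ordinary derivative; \<open>deriv_poly_exp\<close> recovers \<open>\<partial>(p e\<^sup>g) = (p' + p g') e\<^sup>g\<close>.
\<close>

definition fun_scale :: "complex \<Rightarrow> (complex \<Rightarrow> complex) \<Rightarrow> complex \<Rightarrow> complex" where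
  "fun_scale c \<phi> = (\<lambda>t. c * \<phi> t)"

definition poly_exp :: "complex poly \<Rightarrow> complex poly \<Rightarrow> complex \<Rightarrow> complex" where
  "poly_exp g p = (\<lambda>t. poly p t * exp (poly g t))"

definition T1 :: "complex poly \<Rightarrow> (complex \<Rightarrow> complex) set" where
  "T1 g = range (poly_exp g)"

definition T1_e :: "complex \<Rightarrow> (complex \<Rightarrow> complex) \<Rightarrow> complex \<Rightarrow> complex" where
  "T1_e b \<phi> = (\<lambda>t. t\<^sup>2 * deriv \<phi> t + 2 * b * t * \<phi> t)"

definition T1_f :: "(complex \<Rightarrow> complex) \<Rightarrow> complex \<Rightarrow> complex" where
  "T1_f \<phi> = (\<lambda>t. - deriv \<phi> t)"

definition T1_h :: "complex \<Rightarrow> (complex \<Rightarrow> complex) \<Rightarrow> complex \<Rightarrow> complex" where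
  "T1_h b \<phi> = (\<lambda>t. t * deriv \<phi> t + b * \<phi> t)"

text \<open>The linear extension to \<open>sl(2)\<close>, with the coordinates of \<open>sl2_decomposition\<close>.\<close>

definition T1_act :: "complex \<Rightarrow> complex^2^2 \<Rightarrow> (complex \<Rightarrow> complex) \<Rightarrow> complex \<Rightarrow> complex" where
  "T1_act b X \<phi> = fun_scale (X$1$2) (T1_e b \<phi>) + fun_scale (X$2$1) (T1_f \<phi>)
     + fun_scale (2 * X$1$1) (T1_h b \<phi>)"

lemma T1_act_basis:
  "T1_act b sl2_e = T1_e b" "T1_act b sl2_f = T1_f" "T1_act b sl2_h = T1_h b"
  by (simp_all add: fun_eq_iff T1_act_def fun_scale_def sl2_basis_defs)

lemma deriv_poly_exp: "deriv (poly_exp g p) = poly_exp g (pderiv p + p * pderiv g)"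
proof
  fix t
  have "(poly_exp g p has_field_derivative poly_exp g (pderiv p + p * pderiv g) t) (at t)"
    unfolding poly_exp_def by (auto intro!: derivative_eq_intros simp: algebra_simps)
  then show "deriv (poly_exp g p) t = poly_exp g (pderiv p + p * pderiv g) t"
    by (rule DERIV_imp_deriv)
qed

lemma T1_act_poly_exp:
  "T1_act b X (poly_exp g p) =
    poly_exp g (smult (X$1$2) ([:0, 0, 1:] * (pderiv p + p * pderiv g) + [:0, 2 * b:] * p)
      - smult (X$2$1) (pderiv p + p * pderiv g)
      + smult (2 * X$1$1) ([:0, 1:] * (pderiv p + p * pderiv g) + smult b p))"
  by (simp add: fun_eq_iff T1_act_def fun_scale_def T1_e_def T1_f_def T1_h_def deriv_poly_exp)
    (simp add: poly_exp_def algebra_simps power2_eq_square)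

lemma T1_lie_module: "lie_module mat_scale sl2 comm fun_scale (T1 g) (T1_act b)"
proof -
  interpret sl: lie_algebra mat_scale sl2 comm by (rule sl2_lie_algebra)
  interpret F: vector_space fun_scale
    by unfold_locales (simp_all add: fun_scale_def fun_eq_iff algebra_simps)
  have add: "poly_exp g p + poly_exp g q = poly_exp g (p + q)" for p q
    by (simp add: poly_exp_def fun_eq_iff algebra_simps)
  have diff: "poly_exp g p - poly_exp g q = poly_exp g (p - q)" for p q
    by (simp add: poly_exp_def fun_eq_iff algebra_simps)
  have scale: "fun_scale c (poly_exp g p) = poly_exp g (smult c p)" for c p
    by (simp add: poly_exp_def fun_eq_iff fun_scale_def)
  have zero: "0 = poly_exp g 0"
    by (simp add: poly_exp_def fun_eq_iff)
  show ?thesis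
  proof
    show "F.subspace (T1 g)"
      unfolding F.subspace_def T1_def using add scale zero by auto
  next
    fix X v assume "X \<in> sl2" "v \<in> T1 g"
    then show "T1_act b X v \<in> T1 g"
      by (auto simp: T1_def T1_act_poly_exp)
  next
    fix X Y v assume "X \<in> sl2" "Y \<in> sl2" "v \<in> T1 g"
    then show "T1_act b (X + Y) v = T1_act b X v + T1_act b Y v"
      by (simp add: T1_act_def fun_scale_def fun_eq_iff algebra_simps)
  next
    fix X v c assume "X \<in> sl2" "v \<in> T1 g"
    then show "T1_act b (mat_scale c X) v = fun_scale c (T1_act b X v)"
      by (simp add: T1_act_def fun_scale_def mat_scale_def fun_eq_iff algebra_simps)
  next
    fix X v w assume "X \<in> sl2" "v \<in> T1 g" "w \<in> T1 g"
    then obtain p q where "v = poly_exp g p" "w = poly_exp g q"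
      by (auto simp: T1_def)
    then show "T1_act b X (v + w) = T1_act b X v + T1_act b X w"
      by (simp add: add T1_act_poly_exp)
        (rule arg_cong[of _ _ "poly_exp g"], simp add: pderiv_add algebra_simps smult_add_right)
  next
    fix X v c assume "X \<in> sl2" "v \<in> T1 g"
    then obtain p where "v = poly_exp g p"
      by (auto simp: T1_def)
    then show "T1_act b X (fun_scale c v) = fun_scale c (T1_act b X v)"
      by (simp add: scale T1_act_poly_exp)
        (rule arg_cong[of _ _ "poly_exp g"],
          simp add: pderiv_smult algebra_simps smult_add_right smult_diff_right)
  next
    fix X Y v assume X: "X \<in> sl2" and Y: "Y \<in> sl2" and "v \<in> T1 g"
    then obtain p where v: "v = poly_exp g p"
      by (auto simp: T1_def)
    have X2: "X$2$2 = - X$1$1" and Y2: "Y$2$2 = - Y$1$1"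
      using X Y by (simp_all add: sl2_def trace_def sum_2 add_eq_0_iff)
    show "T1_act b (comm X Y) v = T1_act b X (T1_act b Y v) - T1_act b Y (T1_act b X v)"
      unfolding v T1_act_poly_exp diff
      by (rule arg_cong[of _ _ "poly_exp g"], subst poly_eq_poly_eq_iff[symmetric], rule ext)
        (simp add: comm_def matrix_matrix_mult_def sum_2 X2 Y2 pderiv_add pderiv_diff pderiv_smult
          pderiv_mult pderiv_pCons algebra_simps)
  qed
qed

end

theory Submission
  imports Defs
begin

text \<open>
  Let \<open>D p = p' + p g'\<close> on \<open>\<complex>[t]\<close>, so that \<open>e = t\<^sup>2D + 2bt\<close>, \<open>f = -D\<close>, \<open>h = tD + b\<close>, and
  \<open>D\<close> raises degrees by \<open>deg g - 1 \<ge> 1\<close>.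

  If \<open>b = 1 + k/2\<close>, then \<open>D\<^bsup>k+1\<^esup>\<close> intertwines the modules with parameters \<open>-k/2\<close> and
  \<open>b\<close>, so its image is a submodule, which is proper because it contains no nonzero constant.

  Otherwise let \<open>N \<noteq> 0\<close> be a submodule. The degrees occurring in \<open>N\<close> are closed under adding
  \<open>deg g - 1\<close> and \<open>deg g\<close>, so \<open>N\<close> has finite codimension. The polynomials all of whose multiples
  by powers of \<open>t\<close> lie in \<open>N + D\<complex>[t]\<close> form a \<open>D\<close>-stable ideal, and they include \<open>N\<close> because
  \<open>t\<^sup>k(ep) = D(t\<^bsup>k+2\<^esup>p) + (2b - k - 2)t\<^bsup>k+1\<^esup>p\<close>. A nonzero \<open>D\<close>-stable ideal is
  also stable under \<open>d/dt\<close>, so it contains \<open>1\<close>. Hence \<open>D\<close> is surjective on the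
  quotient by \<open>N\<close>, and therefore injective. Since \<open>D(tp) = hp + (1 - b)p\<close>, now \<open>N\<close> itself is a \<open>D\<close>-stable ideal.
\<close>

section \<open>The twisted derivative and its effect on degrees\<close>

definition twisted_deriv :: "'a::idom poly \<Rightarrow> 'a poly \<Rightarrow> 'a poly" where
  "twisted_deriv c p = pderiv p + p * c"

lemma twisted_deriv_simps [simp]:
  "twisted_deriv c 0 = 0"
  "twisted_deriv c (p + q) = twisted_deriv c p + twisted_deriv c q"
  "twisted_deriv c (p - q) = twisted_deriv c p - twisted_deriv c q"
  "twisted_deriv c (smult a p) = smult a (twisted_deriv c p)"
  by (simp_all add: twisted_deriv_def pderiv_add pderiv_diff pderiv_smult algebra_simps
      smult_add_right)

lemma twisted_deriv_funpow [simp]: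
  "(twisted_deriv c ^^ n) 0 = 0"
  "(twisted_deriv c ^^ n) (p + q) = (twisted_deriv c ^^ n) p + (twisted_deriv c ^^ n) q"
  "(twisted_deriv c ^^ n) (p - q) = (twisted_deriv c ^^ n) p - (twisted_deriv c ^^ n) q"
  "(twisted_deriv c ^^ n) (smult a p) = smult a ((twisted_deriv c ^^ n) p)"
  by (induction n) simp_all

lemma poly_extI:
  fixes p q :: "'a::field_char_0 poly"
  assumes "\<And>x. poly p x = poly q x"
  shows "p = q"
  using assms by (simp flip: poly_eq_poly_eq_iff add: fun_eq_iff)

lemma twisted_deriv_mult:
  "twisted_deriv c (p * q) = pderiv p * q + p * twisted_deriv c q"
  by (simp add: twisted_deriv_def pderiv_mult algebra_simps)

lemma twisted_deriv_mult_X: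
  "twisted_deriv c ([:0, 1:] * p) = p + [:0, 1:] * twisted_deriv c p"
  by (simp add: twisted_deriv_def pderiv_pCons add.assoc)

lemma degree_pderiv_le: "degree (pderiv p) \<le> degree p - 1"
  by (rule degree_le) (auto simp: coeff_pderiv coeff_eq_0)

text \<open>\<open>p * c\<close> has strictly larger degree than \<open>pderiv p\<close>, so leading
  terms cannot cancel.\<close>

lemma degree_twisted_deriv:
  assumes "p \<noteq> 0" and "0 < degree c"
  shows "degree (twisted_deriv c p) = degree p + degree c"
proof -
  have "c \<noteq> 0" using assms(2) by auto
  then have "degree (pderiv p) < degree (p * c)"
    using assms degree_pderiv_le[of p] by (subst degree_mult_eq) auto
  then show ?thesis
    using assms \<open>c \<noteq> 0\<close> by (simp add: twisted_deriv_def degree_add_eq_right degree_mult_eq)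
qed

lemma twisted_deriv_nonzero:
  assumes "p \<noteq> 0" and "0 < degree c"
  shows "twisted_deriv c p \<noteq> 0"
  using degree_twisted_deriv[OF assms] assms by auto

definition t1_e :: "'a::idom poly \<Rightarrow> 'a \<Rightarrow> 'a poly \<Rightarrow> 'a poly" where
  "t1_e c b p = [:0, 0, 1:] * twisted_deriv c p + [:0, 2 * b:] * p"

definition t1_h :: "'a::idom poly \<Rightarrow> 'a \<Rightarrow> 'a poly \<Rightarrow> 'a poly" where
  "t1_h c b p = [:0, 1:] * twisted_deriv c p + smult b p"

lemma degree_t1_h:
  fixes p :: "'a::idom poly"
  assumes "p \<noteq> 0" and "0 < degree c"
  shows "degree (t1_h c b p) = Suc (degree p + degree c)"
proof -
  have D: "degree ([:0, 1:] * twisted_deriv c p) = Suc (degree p + degree c)"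
    using twisted_deriv_nonzero[OF assms] degree_twisted_deriv[OF assms]
    by (simp add: degree_mult_eq)
  have "degree (smult b p) < Suc (degree p + degree c)"
    using degree_smult_le[of b p] by simp
  then show ?thesis
    unfolding t1_h_def using D by (simp only: degree_add_eq_left)
qed


subsection \<open>Subspaces of the polynomial ring\<close>

locale poly_subspace =
  fixes N :: "'a::field poly set"
  assumes zero: "0 \<in> N"
    and add: "\<lbrakk>p \<in> N; q \<in> N\<rbrakk> \<Longrightarrow> p + q \<in> N"
    and smult: "p \<in> N \<Longrightarrow> smult a p \<in> N"
begin

lemma uminus: "p \<in> N \<Longrightarrow> - p \<in> N"
  using smult[of p "-1"] by simp

lemma diff: "\<lbrakk>p \<in> N; q \<in> N\<rbrakk> \<Longrightarrow> p - q \<in> N"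
  using add[of p "- q"] uminus[of q] by simp

lemma smult_cancel: "\<lbrakk>smult a p \<in> N; a \<noteq> 0\<rbrakk> \<Longrightarrow> p \<in> N"
  using smult[of "smult a p" "inverse a"] by simp

end

text \<open>Bookkeeping for codimension: over a field, the codimension of a subspace of polynomials
  is the number of naturals missing from its degree set.\<close>

definition degrees :: "'a::zero poly set \<Rightarrow> nat set" where
  "degrees N = degree ` (N - {0})"

lemma degreesI: "\<lbrakk>p \<in> N; p \<noteq> 0; degree p = n\<rbrakk> \<Longrightarrow> n \<in> degrees N"
  by (auto simp: degrees_def)

text \<open>Leading-term elimination: subtracting a suitable multiple of an element of
  \<open>A\<close> of the same degree leaves zero or something of smaller degree.\<close>

lemma subspace_subset_if_degrees_subset:
  assumes "poly_subspace A" and "poly_subspace B" and "A \<subseteq> B" and "degrees B \<subseteq> degrees A"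
  shows "B \<subseteq> A"
proof
  interpret A: poly_subspace A by fact
  interpret B: poly_subspace B by fact
  fix p assume "p \<in> B"
  then show "p \<in> A"
  \<comment> \<open>The measure separates \<open>0\<close> from the nonzero constants, which
    \<open>degree\<close> alone does not.\<close>
  proof (induction "if p = 0 then 0 else Suc (degree p)" arbitrary: p rule: less_induct)
    case less
    show ?case
    proof (cases "p = 0")
      case True
      then show ?thesis by (simp add: A.zero)
    next
      case False
      then obtain q where q: "q \<in> A" "q \<noteq> 0" "degree q = degree p"
        using less.prems assms(4) by (force simp: degrees_def)
      have "coeff q (degree p) \<noteq> 0"
        using q(2,3) by (metis leading_coeff_0_iff)
      define s where "s = smult (lead_coeff p / lead_coeff q) q"
      have s: "s \<in> A" "s \<noteq> 0" "degree s = degree p" "lead_coeff s = lead_coeff p"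
        using q False \<open>coeff q (degree p) \<noteq> 0\<close> by (auto simp: s_def A.smult)
      have "p - s \<in> B"
        using less.prems s(1) assms(3) by (auto intro: B.diff)
      moreover have "p - s = 0 \<or> degree (p - s) < degree p"
      proof (cases "degree p = 0")
        case True
        then show ?thesis
          using s by (metis degree_eq_zeroE lead_coeff_pCons(2) right_minus_eq)
      next
        case False
        have "degree (p - s) \<noteq> degree p" if "p - s \<noteq> 0"
          using that s leading_coeff_neq_0[of "p - s"] by (metis coeff_diff right_minus_eq)
        moreover have "degree (p - s) \<le> degree p"
          using s by (simp add: degree_diff_le)
        ultimately show ?thesis by fastforce
      qed
      ultimately have "p - s \<in> A"
        using less.hyps[of "p - s"] False by auto
      then show ?thesis
        using A.add[OF _ s(1)] by fastforce
    qed
  qed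
qed

text \<open>Only degrees below \<open>d\<close> can be gained along the chain. A term with the most
  of them has the same degree set as its successor, hence equals it.\<close>

lemma incseq_subspaces_stabilise:
  fixes K :: "nat \<Rightarrow> 'a::field poly set"
  assumes K: "\<And>n. poly_subspace (K n)" and mono: "incseq K"
    and cofinite: "\<And>n. n \<ge> d \<Longrightarrow> n \<in> degrees (K 0)"
  obtains n where "K (Suc n) = K n"
proof -
  define S where "S n = degrees (K n) \<inter> {..<d}" for n
  have S_mono: "S n \<subseteq> S (Suc n)" for n
    using incseq_SucD[OF mono, of n] by (auto simp: S_def degrees_def)
  have "card (S n) \<le> d" for n
    using card_mono[of "{..<d}" "S n"] by (simp add: S_def)
  then have "\<exists>n. \<forall>k. card (S k) \<le> card (S n)"
    using ex_has_greatest_nat[of "\<lambda>_. True" 0 "\<lambda>n. card (S n)" "Suc d"]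
    by (simp add: less_Suc_eq_le)
  then obtain n where n: "card (S k) \<le> card (S n)" for k by blast
  have "S n = S (Suc n)"
    by (rule card_seteq[OF _ S_mono n]) (simp add: S_def)
  moreover have "k \<in> degrees (K n)" if "k \<ge> d" for k n
    using cofinite[OF that] incseqD[OF mono, of 0 n] by (auto simp: degrees_def)
  ultimately have "degrees (K (Suc n)) \<subseteq> degrees (K n)"
    by (auto simp: S_def set_eq_iff) (meson not_less)
  then have "K (Suc n) \<subseteq> K n"
    by (rule subspace_subset_if_degrees_subset[OF K K incseq_SucD[OF mono]])
  then show thesis
    by (intro that[of n] equalityI incseq_SucD[OF mono])
qed

text \<open>A surjective endomorphism of a finite-dimensional space is injective; the quotient by
  \<open>N\<close> is handled through preimages.\<close>

lemma (in poly_subspace) surj_mod_imp_inj_mod: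
  assumes closed: "\<And>p. p \<in> N \<Longrightarrow> twisted_deriv c p \<in> N"
    and surj: "\<And>p. \<exists>q. p - twisted_deriv c q \<in> N"
    and cofinite: "\<And>n. n \<ge> d \<Longrightarrow> n \<in> degrees N"
    and p: "twisted_deriv c p \<in> N"
  shows "p \<in> N"
proof -
  \<comment> \<open>Preimage of the kernel of the \<open>n\<close>-th power of the map induced on
    the quotient.\<close>
  define K where "K n = {p. (twisted_deriv c ^^ n) p \<in> N}" for n
  have K: "poly_subspace (K n)" for n
    by unfold_locales (simp_all add: K_def zero add smult)
  have "incseq K"
    by (rule incseq_SucI) (auto simp: K_def closed)
  moreover have "degrees (K 0) = degrees N"
    by (simp add: K_def)
  ultimately obtain n where n: "K (Suc n) = K n"
    using incseq_subspaces_stabilise[of K d, OF K] cofinite by auto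
  have closed_pow: "(twisted_deriv c ^^ k) q \<in> N" if "q \<in> N" for k q
    using that by (induction k) (auto intro: closed)
  have surj_pow: "\<exists>q. p - (twisted_deriv c ^^ k) q \<in> N" for k
  proof (induction k)
    case 0
    show ?case by (rule exI[of _ p]) (simp add: zero)
  next
    case (Suc k)
    then obtain q where q: "p - (twisted_deriv c ^^ k) q \<in> N" by blast
    obtain r where r: "q - twisted_deriv c r \<in> N" using surj by blast
    have "p - (twisted_deriv c ^^ Suc k) r
        = (p - (twisted_deriv c ^^ k) q) + (twisted_deriv c ^^ k) (q - twisted_deriv c r)"
      by (simp add: funpow_Suc_right del: funpow.simps)
    also have "\<dots> \<in> N"
      using q closed_pow[OF r] by (rule add)
    finally show ?case by blast
  qed
  obtain q where q: "p - (twisted_deriv c ^^ n) q \<in> N" using surj_pow by blast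
  \<comment> \<open>The difference is the \<open>Suc n\<close>-th power of the operator applied to
    \<open>q\<close>, so stabilisation of the kernels applies to \<open>q\<close>.\<close>
  have "twisted_deriv c p - twisted_deriv c (p - (twisted_deriv c ^^ n) q) \<in> N"
    using p closed[OF q] by (rule diff)
  then have "q \<in> K (Suc n)" by (simp add: K_def)
  then have "(twisted_deriv c ^^ n) q \<in> N" unfolding n by (simp add: K_def)
  from add[OF q this] show ?thesis by simp
qed

lemma (in poly_subspace) ideal_if_mult_X_closed:
  assumes "\<And>p. p \<in> N \<Longrightarrow> [:0, 1:] * p \<in> N" and "p \<in> N"
  shows "q * p \<in> N"
proof (induction q)
  case 0
  show ?case by (simp add: zero)
next
  case (pCons a q)
  have "pCons a q * p = smult a p + [:0, 1:] * (q * p)"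
    by (simp add: mult_pCons_left)
  then show ?case using add[OF smult[OF assms(2)] assms(1)[OF pCons(2)]] by simp
qed

text \<open>Subtracting \<open>c * p\<close> from \<open>twisted_deriv c p\<close> recovers the
  ordinary derivative. In characteristic 0 it lowers positive degrees by exactly one, so iteration
  ends in a nonzero constant, a unit.\<close>

lemma stable_ideal_eq_UNIV:
  fixes c :: "'a::field_char_0 poly"
  assumes "poly_subspace N"
    and X: "\<And>p. p \<in> N \<Longrightarrow> [:0, 1:] * p \<in> N"
    and D: "\<And>p. p \<in> N \<Longrightarrow> twisted_deriv c p \<in> N"
    and "p \<in> N" and "p \<noteq> 0"
  shows "N = UNIV"
proof -
  interpret poly_subspace N by fact
  have "\<exists>r\<in>N. r \<noteq> 0 \<and> degree r = 0"
    using assms(4,5)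
  proof (induction "degree p" arbitrary: p)
    case 0
    then show ?case by auto
  next
    case (Suc n)
    have "twisted_deriv c p - c * p \<in> N"
      using D ideal_if_mult_X_closed[OF X] Suc.prems by (intro diff)
    then have "pderiv p \<in> N" by (simp add: twisted_deriv_def mult.commute)
    moreover have "pderiv p \<noteq> 0" "degree (pderiv p) = n"
      using Suc(2) by (auto simp: pderiv_eq_0_iff degree_pderiv)
    ultimately show ?case using Suc(1)[of "pderiv p"] by simp
  qed
  then obtain a where a: "[:a:] \<in> N" "a \<noteq> 0"
    by (auto elim!: degree_eq_zeroE)
  have "q \<in> N" for q
    using ideal_if_mult_X_closed[OF X a(1), of "smult (inverse a) q"] a(2) by simp
  then show ?thesis by auto
qed


subsection \<open>Submodules\<close>

text \<open>With \<open>c = pderiv g\<close>, these are the submodules of \<open>T1 g\<close> read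
  off on the polynomial factor. \<open>closed_D\<close> encodes the action of f, since subspaces are
  closed under negation.\<close>

locale t1_submodule = poly_subspace N for N :: "'a::field_char_0 poly set" +
  fixes c :: "'a poly" and b :: 'a
  assumes degree_c: "0 < degree c"
    and closed_D: "p \<in> N \<Longrightarrow> twisted_deriv c p \<in> N"
    and closed_h: "p \<in> N \<Longrightarrow> t1_h c b p \<in> N"
    and closed_e: "p \<in> N \<Longrightarrow> t1_e c b p \<in> N"
begin

text \<open>With \<open>m = degree c\<close>, D raises degrees by \<open>m\<close> and h by
  \<open>m + 1\<close>. Using h in \<open>j\<close> of \<open>i\<close> steps adds
  \<open>i * m + j\<close>, and for \<open>i \<ge> m\<close> these offsets cover all residues mod
  \<open>m\<close>.\<close>

lemma degrees_cofinite:
  assumes "p \<in> N" and "p \<noteq> 0"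
  obtains d where "\<And>n. n \<ge> d \<Longrightarrow> n \<in> degrees N"
proof -
  define m where "m = degree c"
  have D: "k + m \<in> degrees N" if k: "k \<in> degrees N" for k
  proof -
    obtain q where "q \<in> N" "q \<noteq> 0" "degree q = k" using k by (auto simp: degrees_def)
    then show ?thesis
      by (intro degreesI[OF closed_D[of q]])
        (simp_all add: degree_twisted_deriv twisted_deriv_nonzero degree_c m_def)
  qed
  have h: "Suc (k + m) \<in> degrees N" if k: "k \<in> degrees N" for k
  proof -
    obtain q where q: "q \<in> N" "q \<noteq> 0" "degree q = k" using k by (auto simp: degrees_def)
    have "degree (t1_h c b q) = Suc (k + m)"
      using q degree_c by (simp add: m_def degree_t1_h)
    then show ?thesis
      by (intro degreesI[OF closed_h[OF q(1)]]) auto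
  qed
  have step: "degree p + i * m + j \<in> degrees N" if "j \<le> i" for i j
    using that
  proof (induction i arbitrary: j)
    case 0
    then show ?case using assms by (auto intro: degreesI)
  next
    case (Suc i)
    show ?case
    proof (cases "j \<le> i")
      case True
      from D[OF Suc.IH[OF this]] show ?thesis by (simp add: algebra_simps)
    next
      case False
      then have "j = Suc i" using Suc.prems by simp
      with h[OF Suc.IH[of i]] show ?thesis by (simp add: algebra_simps)
    qed
  qed
  \<comment> \<open>The bound \<open>m * m\<close> makes the quotient \<open>i\<close> at least
    \<open>m\<close>, so the remainder satisfies \<open>j < m \<le> i\<close>.\<close>
  have "n \<in> degrees N" if n: "n \<ge> degree p + m * m" for n
  proof -
    define i where "i = (n - degree p) div m"
    define j where "j = (n - degree p) mod m"
    have "m > 0" using degree_c by (simp add: m_def)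
    have "n = degree p + i * m + j"
      using n by (simp add: i_def j_def)
    moreover have "m \<le> i"
      using n \<open>m > 0\<close> by (simp add: i_def less_eq_div_iff_mult_less_eq)
    moreover have "j < m"
      using \<open>m > 0\<close> by (simp add: j_def)
    ultimately show ?thesis using step[of j i] by simp
  qed
  then show thesis by (rule that)
qed

lemma eq_UNIV:
  assumes b: "\<And>k. 2 * b \<noteq> of_nat (k + 2)" and p0: "p0 \<in> N" "p0 \<noteq> 0"
  shows "N = UNIV"
proof -
  \<comment> \<open>The sum of \<open>N\<close> and the image of D; surjectivity on the quotient
    means \<open>W = UNIV\<close>.\<close>
  define W where "W = {p. \<exists>q. p - twisted_deriv c q \<in> N}"
  interpret W: poly_subspace W
  proof
    show "0 \<in> W"
      unfolding W_def using zero by (auto intro: exI[of _ 0])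
    show "p + q \<in> W" if pq: "p \<in> W" "q \<in> W" for p q
    proof -
      obtain p' q' where "p - twisted_deriv c p' \<in> N" "q - twisted_deriv c q' \<in> N"
        using pq by (auto simp: W_def)
      from add[OF this] have "p + q - twisted_deriv c (p' + q') \<in> N"
        by (simp add: algebra_simps)
      then show ?thesis unfolding W_def by blast
    qed
    show "smult a p \<in> W" if p: "p \<in> W" for a p
    proof -
      obtain q where "p - twisted_deriv c q \<in> N" using p by (auto simp: W_def)
      from smult[OF this, of a] have "smult a p - twisted_deriv c (smult a q) \<in> N"
        by (simp add: smult_diff_right)
      then show ?thesis unfolding W_def by blast
    qed
  qed
  have N_W: "p \<in> W" if "p \<in> N" for p
    unfolding W_def using that by (auto intro: exI[of _ 0])
  have D_W: "twisted_deriv c p \<in> W" for p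
    unfolding W_def using zero by (auto intro: exI[of _ p])
  \<comment> \<open>The largest ideal contained in \<open>W\<close>.\<close>
  define K where "K = {p. \<forall>k. monom 1 k * p \<in> W}"
  interpret K: poly_subspace K
    by unfold_locales (auto simp: K_def W.zero W.add W.smult distrib_left)
  have "K = UNIV"
  proof (rule stable_ideal_eq_UNIV[OF K.poly_subspace_axioms])
    fix p assume p: "p \<in> K"
    have "monom 1 k * ([:0, 1:] * p) = monom 1 (Suc k) * p" for k
      by (simp add: monom_Suc)
    then show "[:0, 1:] * p \<in> K" using p by (auto simp: K_def)
    have "monom 1 k * twisted_deriv c p \<in> W" for k
    proof -
      \<comment> \<open>Product rule; at \<open>k = 0\<close> the factor \<open>of_nat k\<close>
        kills the term with the truncated exponent.\<close>
      have "monom 1 k * twisted_deriv c p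
          = twisted_deriv c (monom 1 k * p) - smult (of_nat k) (monom 1 (k - 1) * p)"
        by (intro poly_extI) (simp add: twisted_deriv_mult pderiv_monom poly_monom)
      then show ?thesis
        using p by (simp add: K_def D_W W.diff W.smult)
    qed
    then show "twisted_deriv c p \<in> K" by (simp add: K_def)
  next
    have "monom 1 k * p \<in> W" if "p \<in> N" for k p
      using that
    proof (induction k arbitrary: p)
      case 0
      then show ?case by (simp add: N_W)
    next
      case (Suc k)
      \<comment> \<open>The induction hypothesis is applied to \<open>t1_e c b p\<close>, again in
        \<open>N\<close>; the condition on \<open>b\<close> makes the scalar invertible.\<close>
      have "monom 1 k * t1_e c b p = twisted_deriv c (monom 1 (k + 2) * p)
          + smult (2 * b - of_nat (k + 2)) (monom 1 (Suc k) * p)"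
        by (intro poly_extI) (simp add: t1_e_def twisted_deriv_def pderiv_mult pderiv_monom
            poly_monom algebra_simps)
      from W.diff[OF Suc.IH[OF closed_e[OF Suc.prems], unfolded this]
          D_W[of "monom 1 (k + 2) * p"]]
      have "smult (2 * b - of_nat (k + 2)) (monom 1 (Suc k) * p) \<in> W" by simp
      then show ?case by (rule W.smult_cancel) (use b[of k] in simp)
    qed
    then show "p0 \<in> K" using p0 by (simp add: K_def)
  qed (use p0 in simp)
  then have "monom 1 0 * p \<in> W" for p
    using UNIV_I[of p] unfolding K_def by blast
  then have "p \<in> W" for p
    by simp
  then have surj: "\<exists>q. p - twisted_deriv c q \<in> N" for p
    by (simp add: W_def)
  obtain d where d: "\<And>n. n \<ge> d \<Longrightarrow> n \<in> degrees N" using degrees_cofinite p0 by blast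
  have inj: "p \<in> N" if "twisted_deriv c p \<in> N" for p
    using closed_D surj d that by (rule surj_mod_imp_inj_mod)
  show ?thesis
  proof (rule stable_ideal_eq_UNIV[OF poly_subspace_axioms])
    fix p assume p: "p \<in> N"
    \<comment> \<open>Injectivity modulo \<open>N\<close> turns closure under h into closure under
      multiplication by t.\<close>
    have "twisted_deriv c ([:0, 1:] * p) = t1_h c b p + smult (1 - b) p"
      by (simp add: twisted_deriv_mult_X t1_h_def smult_diff_left del: mult_pCons_left)
    then have "twisted_deriv c ([:0, 1:] * p) \<in> N"
      using p by (simp add: add closed_h smult del: mult_pCons_left)
    then show "[:0, 1:] * p \<in> N" by (rule inj)
  qed (use p0 closed_D in simp_all)
qed

end

section \<open>Commuting powers of D past the operators h and e\<close>

lemma twisted_deriv_funpow_mult_X: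
  "(twisted_deriv c ^^ n) ([:0, 1:] * p)
    = [:0, 1:] * (twisted_deriv c ^^ n) p + smult (of_nat n) ((twisted_deriv c ^^ (n - 1)) p)"
proof (induction n)
  case (Suc n)
  have "smult (of_nat n) (twisted_deriv c ((twisted_deriv c ^^ (n - 1)) p))
      = smult (of_nat n) ((twisted_deriv c ^^ n) p)"
    by (cases n) simp_all
  then show ?case
    by (simp add: Suc twisted_deriv_mult_X smult_add_left add_ac del: mult_pCons_left)
qed simp

text \<open>As hD = D(h - 1), each D that h passes lowers the parameter by one.\<close>

lemma t1_h_funpow:
  "t1_h c b ((twisted_deriv c ^^ n) p) = (twisted_deriv c ^^ n) (t1_h c (b - of_nat n) p)"
proof (cases n)
  case (Suc m)
  have "(twisted_deriv c ^^ m) (twisted_deriv c p) = (twisted_deriv c ^^ n) p"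
    unfolding Suc funpow_Suc_right by simp
  moreover have "twisted_deriv c ((twisted_deriv c ^^ n) p)
      = (twisted_deriv c ^^ n) (twisted_deriv c p)"
    by (metis funpow_swap1)
  ultimately show ?thesis
    by (simp add: t1_h_def twisted_deriv_funpow_mult_X smult_diff_left Suc
        del: mult_pCons_left funpow.simps)
qed simp

text \<open>For parameter \<open>a\<close> and \<open>n = k + 1\<close>, moving the
  \<open>n\<close>-th power of D past e leaves the term \<open>n * (n - 1 + 2 * a)\<close> times the
  \<open>k\<close>-th power and turns \<open>2 * a\<close> into \<open>2 * n + 2 * a\<close>. At
  \<open>a = - k / 2\<close> the former vanishes and the latter is \<open>k + 2\<close>.\<close>

lemma t1_e_funpow:
  fixes c :: "'a::field_char_0 poly"
  shows "t1_e c (1 + of_nat k / 2) ((twisted_deriv c ^^ Suc k) p)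
    = (twisted_deriv c ^^ Suc k) (t1_e c (- of_nat k / 2) p)"
proof -
  let ?D = "twisted_deriv c" and ?X = "[:0, 1:] :: 'a poly"
  have shift: "(?D ^^ n) (?D q) = ?D ((?D ^^ n) q)" for n q
    by (metis funpow_swap1)
  have e: "t1_e c a q = ?X * (?X * ?D q) + smult (2 * a) (?X * q)" for a q
    by (rule poly_extI) (simp add: t1_e_def algebra_simps)
  \<comment> \<open>At \<open>k = 0\<close>, where \<open>k - 1\<close> truncates, both sides
    vanish.\<close>
  have pred: "smult (of_nat k) ((?D ^^ (k - 1)) (?D p)) = smult (of_nat k) ((?D ^^ k) p)"
    by (cases k) (simp_all add: shift)
  have "(?D ^^ Suc k) (t1_e c (- of_nat k / 2) p)
      = (?D ^^ Suc k) (?X * (?X * ?D p)) - smult (of_nat k) ((?D ^^ Suc k) (?X * p))"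
    unfolding e twisted_deriv_funpow(2,4) by simp
  also have "\<dots> = ?X * (?X * ?D ((?D ^^ Suc k) p))
      + smult (of_nat (k + 2)) (?X * (?D ^^ Suc k) p)
      + smult (of_nat (Suc k))
          (smult (of_nat k) ((?D ^^ (k - 1)) (?D p)) - smult (of_nat k) ((?D ^^ k) p))"
    unfolding twisted_deriv_funpow_mult_X shift
    by (rule poly_extI) (simp add: shift algebra_simps)
  also have "\<dots> = t1_e c (1 + of_nat k / 2) ((?D ^^ Suc k) p)"
    unfolding e pred by (simp add: algebra_simps)
  finally show ?thesis ..
qed


subsection \<open>The modules \<open>T\<^sub>1(g,b)\<close>\<close>

lemma poly_exp_add: "poly_exp g p + poly_exp g q = poly_exp g (p + q)"
  by (simp add: poly_exp_def fun_eq_iff algebra_simps)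

lemma poly_exp_scale: "fun_scale a (poly_exp g p) = poly_exp g (smult a p)"
  by (simp add: poly_exp_def fun_eq_iff fun_scale_def)

lemma poly_exp_0: "poly_exp g 0 = 0"
  by (simp add: poly_exp_def fun_eq_iff)

text \<open>The exponential factor never vanishes, so it cancels pointwise.\<close>

lemma poly_exp_eq_iff [simp]: "poly_exp g p = poly_exp g q \<longleftrightarrow> p = q"
  by (simp add: poly_exp_def fun_eq_iff flip: poly_eq_poly_eq_iff)

lemma T1_act_eq:
  "T1_act b X (poly_exp g p) = poly_exp g (smult (X$1$2) (t1_e (pderiv g) b p)
    - smult (X$2$1) (twisted_deriv (pderiv g) p) + smult (2 * X$1$1) (t1_h (pderiv g) b p))"
  by (simp add: T1_act_poly_exp t1_e_def t1_h_def twisted_deriv_def)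

lemma T1_lie_submodule_iff:
  assumes "degree g \<ge> 2"
  shows "lie_module.lie_submodule sl2 fun_scale (T1 g) (T1_act b) (poly_exp g ` P)
    \<longleftrightarrow> t1_submodule P (pderiv g) b"
proof -
  interpret M: lie_module mat_scale sl2 comm fun_scale "T1 g" "T1_act b"
    by (rule T1_lie_module)
  have in_P: "poly_exp g p \<in> poly_exp g ` P \<longleftrightarrow> p \<in> P" for p
    by auto
  show ?thesis
  proof
    assume sub: "M.lie_submodule (poly_exp g ` P)"
    then have act: "T1_act b X (poly_exp g p) \<in> poly_exp g ` P" if "X \<in> sl2" "p \<in> P" for X p
      using that by (auto simp: M.lie_submodule_def)
    have sp: "M.MV.subspace (poly_exp g ` P)"
      using sub by (simp add: M.lie_submodule_def)
    interpret poly_subspace P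
    proof
      show "0 \<in> P"
        using M.MV.subspace_0[OF sp] in_P[of 0] by (simp add: poly_exp_0)
      show "p + q \<in> P" if "p \<in> P" "q \<in> P" for p q
        using M.MV.subspace_add[OF sp imageI[OF that(1)] imageI[OF that(2)]] in_P
        by (simp only: poly_exp_add)
      show "smult a p \<in> P" if "p \<in> P" for a p
        using M.MV.subspace_scale[OF sp imageI[OF that]] in_P by (simp only: poly_exp_scale)
    qed
    show "t1_submodule P (pderiv g) b"
    proof
      show "0 < degree (pderiv g)"
        using assms by (simp add: degree_pderiv)
      fix p assume p: "p \<in> P"
      show "twisted_deriv (pderiv g) p \<in> P"
        using act[OF sl2_basis_in(2) p] uminus[of "- twisted_deriv (pderiv g) p"]
        by (simp add: T1_act_eq sl2_basis_defs in_P del: image_iff)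
      show "t1_h (pderiv g) b p \<in> P"
        using act[OF sl2_basis_in(3) p] by (simp add: T1_act_eq sl2_basis_defs in_P del: image_iff)
      show "t1_e (pderiv g) b p \<in> P"
        using act[OF sl2_basis_in(1) p] by (simp add: T1_act_eq sl2_basis_defs in_P del: image_iff)
    qed
  next
    assume "t1_submodule P (pderiv g) b"
    then interpret t1_submodule P "pderiv g" b .
    show "M.lie_submodule (poly_exp g ` P)"
      unfolding M.lie_submodule_def M.MV.subspace_def
    proof (intro conjI ballI allI)
      show "poly_exp g ` P \<subseteq> T1 g"
        by (auto simp: T1_def)
      show "0 \<in> poly_exp g ` P"
        using zero in_P[of 0] by (simp add: poly_exp_0)
    qed (auto simp: poly_exp_add poly_exp_scale T1_act_eq
        intro!: imageI add diff smult closed_D closed_h closed_e)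
  qed
qed

lemma t1_submodule_range_funpow:
  fixes c :: "'a::field_char_0 poly"
  assumes "0 < degree c"
  shows "t1_submodule (range (twisted_deriv c ^^ Suc k)) c (1 + of_nat k / 2)"
proof
  show "0 \<in> range (twisted_deriv c ^^ Suc k)"
    by (rule range_eqI[of _ _ 0]) (simp only: twisted_deriv_funpow)
next
  fix p q assume "p \<in> range (twisted_deriv c ^^ Suc k)" "q \<in> range (twisted_deriv c ^^ Suc k)"
  then obtain p' q' where "p = (twisted_deriv c ^^ Suc k) p'" "q = (twisted_deriv c ^^ Suc k) q'"
    by blast
  then show "p + q \<in> range (twisted_deriv c ^^ Suc k)"
    by (intro range_eqI[of _ _ "p' + q'"]) (simp only: twisted_deriv_funpow)
next
  fix a p assume "p \<in> range (twisted_deriv c ^^ Suc k)"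
  then obtain p' where "p = (twisted_deriv c ^^ Suc k) p'" by blast
  then show "smult a p \<in> range (twisted_deriv c ^^ Suc k)"
    by (intro range_eqI[of _ _ "smult a p'"]) (simp only: twisted_deriv_funpow)
next
  fix p assume "p \<in> range (twisted_deriv c ^^ Suc k)"
  then obtain q where q: "p = (twisted_deriv c ^^ Suc k) q" by blast
  show "twisted_deriv c p \<in> range (twisted_deriv c ^^ Suc k)"
    unfolding q by (metis funpow_swap1 rangeI)
  show "t1_h c (1 + of_nat k / 2) p \<in> range (twisted_deriv c ^^ Suc k)"
    unfolding q t1_h_funpow by (rule rangeI)
  show "t1_e c (1 + of_nat k / 2) p \<in> range (twisted_deriv c ^^ Suc k)"
    unfolding q t1_e_funpow by (rule rangeI)
qed fact

theorem theorem6p17: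
  fixes b :: complex and g :: "complex poly"
  assumes "coeff g 0 = 0" and "degree g \<ge> 2"
  shows "simple_lie_module mat_scale sl2 comm fun_scale (T1 g) (T1_act b)
    \<longleftrightarrow> b \<notin> {1 + of_nat k / 2 | k :: nat. True}"
proof -
  define c where "c = pderiv g"
  have c: "0 < degree c"
    using assms(2) by (simp add: c_def degree_pderiv)
  interpret M: lie_module mat_scale sl2 comm fun_scale "T1 g" "T1_act b"
    by (rule T1_lie_module)
  show ?thesis
  proof
    assume "simple_lie_module mat_scale sl2 comm fun_scale (T1 g) (T1_act b)"
    then interpret S: simple_lie_module mat_scale sl2 comm fun_scale "T1 g" "T1_act b" .
    show "b \<notin> {1 + of_nat k / 2 | k :: nat. True}"
    proof
      assume "b \<in> {1 + of_nat k / 2 | k :: nat. True}"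
      then obtain k where k: "b = 1 + of_nat k / 2" by blast
      let ?P = "range (twisted_deriv c ^^ Suc k)"
      have "M.lie_submodule (poly_exp g ` ?P)"
        unfolding T1_lie_submodule_iff[OF assms(2)] k
        using t1_submodule_range_funpow[of c k] c by (simp only: c_def)
      then consider "poly_exp g ` ?P = {0}" | "poly_exp g ` ?P = T1 g"
        using S.submodule_cases by blast
      then show False
      proof cases
        case 1
        have "(twisted_deriv c ^^ n) 1 \<noteq> 0" for n
          by (induction n) (simp_all add: twisted_deriv_nonzero c)
        moreover have "poly_exp g ((twisted_deriv c ^^ Suc k) 1) \<in> {0}"
          using 1 by blast
        ultimately show False
          using poly_exp_eq_iff[of g _ 0] by (simp only: poly_exp_0 singleton_iff)
      next
        case 2
        then have "poly_exp g 1 \<in> poly_exp g ` ?P" by (simp add: T1_def)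
        then obtain q where "twisted_deriv c ((twisted_deriv c ^^ k) q) = 1" by auto
        then show False
          using degree_twisted_deriv[OF _ c, of "(twisted_deriv c ^^ k) q"] c by force
      qed
    qed
  next
    assume "b \<notin> {1 + of_nat k / 2 | k :: nat. True}"
    then have b: "b \<noteq> 1 + of_nat k / 2" for k
      by blast
    have b2: "2 * b \<noteq> of_nat (k + 2)" for k
      using b[of k] by (auto simp: field_simps)
    show "simple_lie_module mat_scale sl2 comm fun_scale (T1 g) (T1_act b)"
    proof
      have "poly_exp g 1 \<in> T1 g" by (simp add: T1_def)
      moreover have "poly_exp g 1 \<noteq> 0" using poly_exp_eq_iff[of g 1 0] by (simp add: poly_exp_0)
      ultimately show "T1 g \<noteq> {0}" by blast
    next
      fix N assume N: "M.lie_submodule N"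
      define P where "P = poly_exp g -` N"
      have N_P: "N = poly_exp g ` P"
        using N unfolding M.lie_submodule_def P_def by (auto simp: T1_def)
      interpret t1_submodule P "pderiv g" b
        using N unfolding N_P T1_lie_submodule_iff[OF assms(2)] .
      show "N = {0} \<or> N = T1 g"
      proof (cases "P = {0}")
        case True
        then show ?thesis by (simp add: N_P poly_exp_0)
      next
        case False
        then obtain p where "p \<in> P" "p \<noteq> 0" using zero by blast
        then have "P = UNIV" by (rule eq_UNIV[OF b2])
        then show ?thesis by (simp add: N_P T1_def)
      qed
    qed
  qed
qed

end
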